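(* Let $u,p$ be smooth on a time interval (times $\mathbb T^3$), with $\operatorname{div}u=0$ and with the spatial mean of $u$ fixed in time, let $B(t,x)\in\mathbb S^3$ be smooth, and set $A=e^B$, $G=I-A^{-1}$. Let $E$ be a measurable subset of the time interval, and assume that on $E\times\mathbb T^3$ $$\|B\|_{L^\infty}\le\varepsilon,\qquad 0<\varepsilon\le1.$$ Then $$\|G\|_{L^2(E\times\mathbb T^3)}\le e\,\varepsilon\,|E\times\mathbb T^3|^{1/2}.$$ Consequently, if the residual-matching Reynolds state associated with $(u,p,B)$ is energy--entropy admissible, then $$\int_E[P(t)]_+\,dt\le\frac{\alpha e}{2}\,\eta_E\,\varepsilon\,|E\times\mathbb T^3|^{1/2}\,\|\mathcal S[u,B]\|_{L^2(E\times\mathbb T^3)}.$$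
   Context: $\mathbb T^3$ is the flat periodic three-torus (Fourier modes $k\in\mathbb Z^3$); $\mathbb S^3$ is the space of real symmetric $3\times3$ matrices; $I$ is the identity; $M:N=\operatorname{tr}(MN^T)$ is the Frobenius product, and pointwise matrix norms are Frobenius norms. $(\nabla u)_{ij}=\partial_ju_i$, $D(u)=\frac12(\nabla u+(\nabla u)^T)$, divergence of matrix fields acts row-wise. $[x]_+=\max(x,0)$. $\nu,\alpha,\lambda>0$ are fixed parameters; $e$ is Euler's number when it appears as a constant. Residuals: $$\mathcal S[u,B]=\partial_tA+u\cdot\nabla A-\nabla u\,A-A(\nabla u)^T+\lambda^{-1}(A-I),$$ $$\mathcal N[u,B]=\partial_tu+\operatorname{div}(u\otimes u)-\nu\Delta u-\alpha\operatorname{div}(A-I),$$ the latter having zero spatial mean. Anti-divergence $\mathcal A$: for a smooth zero-mean vector field $m$, let $\phi$ be the unique zero-mean solution of $\Delta\phi+\frac13\nabla\operatorname{div}\phi=m$ and $(\mathcal Am)_{ij}=\partial_i\phi_j+\partial_j\phi_i-\frac23\delta_{ij}\operatorname{div}\phi$; then $\operatorname{div}(\mathcal Am)=m$. Put $R_{\mathcal N}=\mathcal A\,\mathcal N[u,B]$ and $P(t)=\int_{\mathbb T^3}-R_{\mathcal N}(t):D(u(t))\,dx$. The residual-matching Reynolds state associated with $(u,p,B)$ has conformation defect $\mathcal S[u,B]$ and momentum defect $R_{\mathcal N}$ modulo the pressure tensor $pI$; it is energy--entropy admissible if, for a.e. $t$, $\int_{\mathbb T^3}\big[-R_{\mathcal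 N}:D(u)+\frac{\alpha}{2}(I-A^{-1}):\mathcal S[u,B]\big]dx\le0$. $$\eta_E=\operatorname*{ess\,sup}_{t\in E}\frac{\big[-\int_{\mathbb T^3}G(t):\mathcal S[u,B](t)\,dx\big]_+}{\|G(t)\|_{L^2}\|\mathcal S[u,B](t)\|_{L^2}},$$ with the ratio set equal to $0$ when the denominator vanishes. *)

theory Defs
  imports "HOL-Probability.Essential_Supremum"
begin

section \<open>The torus\<close>

text \<open>Fourier modes range over the integer lattice, so the torus has period \<open>2\<pi>\<close> in each coordinate.
  Fields on it are periodic functions on \<^typ>\<open>real^3\<close>, integrated over one period cell.\<close>

definition torus :: "(real^3) measure"
  where "torus = lebesgue_on (cbox 0 (\<chi> i. 2 * pi))"

definition periodic :: "(real^3 \<Rightarrow> 'a) \<Rightarrow> bool"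
  where "periodic f \<longleftrightarrow> (\<forall>x i. f (x + (2 * pi) *\<^sub>R axis i 1) = f x)"

definition torus_mean :: "(real^3 \<Rightarrow> 'a::{banach,second_countable_topology}) \<Rightarrow> 'a"
  where "torus_mean f = (1 / (2 * pi) ^ 3) *\<^sub>R (\<integral>x. f x \<partial>torus)"

section \<open>Matrices\<close>

text \<open>On \<^typ>\<open>real^3^3\<close> the class operations \<open>*\<close> and \<open>^\<close> are componentwise, hence the explicit
  matrix powers. The library norm of \<^typ>\<open>real^3^3\<close> is the Frobenius norm (see \<open>norm_eq_frob\<close>).\<close>

definition frob :: "real^3^3 \<Rightarrow> real^3^3 \<Rightarrow> real"  (infix "\<Colon>\<^sub>F" 75)
  where "M \<Colon>\<^sub>F N = trace (M ** transpose N)"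

lemma frob_eq_inner: "M \<Colon>\<^sub>F N = M \<bullet> N"
  by (simp add: frob_def trace_def matrix_matrix_mult_def transpose_def inner_vec_def)

lemma norm_eq_frob: "norm M = sqrt (M \<Colon>\<^sub>F M)"
  by (simp add: frob_eq_inner norm_eq_sqrt_inner)

definition mpow :: "real^3^3 \<Rightarrow> nat \<Rightarrow> real^3^3"
  where "mpow M n = (((**) M) ^^ n) (mat 1)"

definition mexp :: "real^3^3 \<Rightarrow> real^3^3"
  where "mexp M = (\<Sum>n. (1 / fact n) *\<^sub>R mpow M n)"

definition outer :: "real^3 \<Rightarrow> real^3 \<Rightarrow> real^3^3"
  where "outer v w = (\<chi> i j. v $ i * w $ j)"

section \<open>Differential operators\<close>

definition pd :: "3 \<Rightarrow> (real^3 \<Rightarrow> 'a::real_normed_vector) \<Rightarrow> real^3 \<Rightarrow> 'a"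
  where "pd j f x = vector_derivative (\<lambda>h. f (x + h *\<^sub>R axis j 1)) (at 0)"

text \<open>The time derivative is one-sided at endpoints that belong to the time interval \<open>T\<close>.\<close>

definition dt :: "real set \<Rightarrow> (real \<Rightarrow> real^3 \<Rightarrow> 'a::real_normed_vector) \<Rightarrow> real \<Rightarrow> real^3 \<Rightarrow> 'a"
  where "dt T f t x = vector_derivative (\<lambda>s. f s x) (at t within T)"

definition grad :: "(real^3 \<Rightarrow> real) \<Rightarrow> real^3 \<Rightarrow> real^3"
  where "grad q x = (\<chi> i. pd i q x)"

definition vgrad :: "(real^3 \<Rightarrow> real^3) \<Rightarrow> real^3 \<Rightarrow> real^3^3"
  where "vgrad v x = (\<chi> i j. pd j (\<lambda>y. v y $ i) x)"

definition symgrad :: "(real^3 \<Rightarrow> real^3) \<Rightarrow> real^3 \<Rightarrow> real^3^3"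
  where "symgrad v x = (1/2) *\<^sub>R (vgrad v x + transpose (vgrad v x))"

definition vdiv :: "(real^3 \<Rightarrow> real^3) \<Rightarrow> real^3 \<Rightarrow> real"
  where "vdiv v x = (\<Sum>i\<in>UNIV. pd i (\<lambda>y. v y $ i) x)"

definition mdiv :: "(real^3 \<Rightarrow> real^3^3) \<Rightarrow> real^3 \<Rightarrow> real^3"
  where "mdiv M x = (\<chi> i. \<Sum>j\<in>UNIV. pd j (\<lambda>y. M y $ i $ j) x)"

definition laplacian :: "(real^3 \<Rightarrow> 'a::real_normed_vector) \<Rightarrow> real^3 \<Rightarrow> 'a"
  where "laplacian f x = (\<Sum>j\<in>UNIV. pd j (pd j f) x)"

definition advect :: "(real^3 \<Rightarrow> real^3) \<Rightarrow> (real^3 \<Rightarrow> 'a::real_normed_vector) \<Rightarrow> real^3 \<Rightarrow> 'a"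
  where "advect v f x = (\<Sum>k\<in>UNIV. (v x $ k) *\<^sub>R pd k f x)"

section \<open>Smoothness\<close>

text \<open>\<open>Ck T k f\<close>: all mixed space-time partial derivatives of \<open>f\<close> up to order \<open>k\<close> exist on
  \<open>T \<times> \<real>\<^sup>3\<close> and are jointly continuous there.\<close>

primrec Ck :: "real set \<Rightarrow> nat \<Rightarrow> (real \<Rightarrow> real^3 \<Rightarrow> 'a::real_normed_vector) \<Rightarrow> bool"
  where
    "Ck T 0 f \<longleftrightarrow> continuous_on (T \<times> UNIV) (\<lambda>(t, x). f t x)"
  | "Ck T (Suc k) f \<longleftrightarrow>
       continuous_on (T \<times> UNIV) (\<lambda>(t, x). f t x) \<and>
       (\<forall>t\<in>T. \<forall>x. (\<lambda>s. f s x) differentiable (at t within T)) \<and>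
       (\<forall>j. \<forall>t\<in>T. \<forall>x. (\<lambda>h. f t (x + h *\<^sub>R axis j 1)) differentiable (at 0)) \<and>
       Ck T k (dt T f) \<and> (\<forall>j. Ck T k (\<lambda>t. pd j (f t)))"

definition smooth_field :: "real set \<Rightarrow> (real \<Rightarrow> real^3 \<Rightarrow> 'a::real_normed_vector) \<Rightarrow> bool"
  where "smooth_field T f \<longleftrightarrow> (\<forall>k. Ck T k f) \<and> (\<forall>t\<in>T. periodic (f t))"

section \<open>Residuals and anti-divergence\<close>

definition conf :: "(real \<Rightarrow> real^3 \<Rightarrow> real^3^3) \<Rightarrow> real \<Rightarrow> real^3 \<Rightarrow> real^3^3"
  where "conf B t x = mexp (B t x)"

definition conf_residual ::
  "real \<Rightarrow> real set \<Rightarrow> (real \<Rightarrow> real^3 \<Rightarrow> real^3) \<Rightarrow> (real \<Rightarrow> real^3 \<Rightarrow> real^3^3) \<Rightarrow> real \<Rightarrow> real^3 \<Rightarrow> real^3^3"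
  where "conf_residual lam T u B t x =
    (let A = conf B in
       dt T A t x + advect (u t) (A t) x
       - vgrad (u t) x ** A t x - A t x ** transpose (vgrad (u t) x)
       + inverse lam *\<^sub>R (A t x - mat 1))"

definition mom_residual ::
  "real \<Rightarrow> real \<Rightarrow> real set \<Rightarrow> (real \<Rightarrow> real^3 \<Rightarrow> real^3) \<Rightarrow> (real \<Rightarrow> real^3 \<Rightarrow> real^3^3) \<Rightarrow> real \<Rightarrow> real^3 \<Rightarrow> real^3"
  where "mom_residual \<nu> \<alpha> T u B t x =
    dt T u t x + mdiv (\<lambda>y. outer (u t y) (u t y)) x - \<nu> *\<^sub>R laplacian (u t) x
    - \<alpha> *\<^sub>R mdiv (\<lambda>y. conf B t y - mat 1) x"

text \<open>\<open>smooth_field UNIV (\<lambda>_. \<phi>)\<close> says that the time-independent field \<open>\<phi>\<close> is smooth and periodic.\<close>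

definition antidiv_potential :: "(real^3 \<Rightarrow> real^3) \<Rightarrow> real^3 \<Rightarrow> real^3"
  where "antidiv_potential m = (THE \<phi>. smooth_field UNIV (\<lambda>_. \<phi>) \<and> torus_mean \<phi> = 0 \<and>
           (\<forall>x. laplacian \<phi> x + (1/3) *\<^sub>R grad (vdiv \<phi>) x = m x))"

definition antidiv :: "(real^3 \<Rightarrow> real^3) \<Rightarrow> real^3 \<Rightarrow> real^3^3"
  where "antidiv m x = (let \<phi> = antidiv_potential m in
    \<chi> i j. pd i (\<lambda>y. \<phi> y $ j) x + pd j (\<lambda>y. \<phi> y $ i) x
           - 2/3 * (if i = j then 1 else 0) * vdiv \<phi> x)"

definition mom_stress ::
  "real \<Rightarrow> real \<Rightarrow> real set \<Rightarrow> (real \<Rightarrow> real^3 \<Rightarrow> real^3) \<Rightarrow> (real \<Rightarrow> real^3 \<Rightarrow> real^3^3) \<Rightarrow> real \<Rightarrow> real^3 \<Rightarrow> real^3^3"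
  where "mom_stress \<nu> \<alpha> T u B t = antidiv (mom_residual \<nu> \<alpha> T u B t)"

definition stress_power ::
  "real \<Rightarrow> real \<Rightarrow> real set \<Rightarrow> (real \<Rightarrow> real^3 \<Rightarrow> real^3) \<Rightarrow> (real \<Rightarrow> real^3 \<Rightarrow> real^3^3) \<Rightarrow> real \<Rightarrow> real"
  where "stress_power \<nu> \<alpha> T u B t = (\<integral>x. - mom_stress \<nu> \<alpha> T u B t x \<Colon>\<^sub>F symgrad (u t) x \<partial>torus)"

section \<open>Reynolds states and admissibility\<close>

text \<open>The momentum defect of a state is understood modulo its pressure tensor \<open>p I\<close>, and is stored
  without it: the momentum balance reads
  \<open>\<partial>\<^sub>t u + div (u \<otimes> u) + \<nabla>p - \<nu> \<Delta>u - \<alpha> div (A - I) = div (mom_defect + p I)\<close>.\<close>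

record reynolds_state =
  velocity :: "real \<Rightarrow> real^3 \<Rightarrow> real^3"
  pressure :: "real \<Rightarrow> real^3 \<Rightarrow> real"
  log_conf :: "real \<Rightarrow> real^3 \<Rightarrow> real^3^3"
  mom_defect :: "real \<Rightarrow> real^3 \<Rightarrow> real^3^3"
  conf_defect :: "real \<Rightarrow> real^3 \<Rightarrow> real^3^3"

definition residual_matching_state ::
  "real \<Rightarrow> real \<Rightarrow> real \<Rightarrow> real set \<Rightarrow> (real \<Rightarrow> real^3 \<Rightarrow> real^3) \<Rightarrow> (real \<Rightarrow> real^3 \<Rightarrow> real)
    \<Rightarrow> (real \<Rightarrow> real^3 \<Rightarrow> real^3^3) \<Rightarrow> reynolds_state"
  where "residual_matching_state \<nu> \<alpha> lam T u p B =
    \<lparr> velocity = u, pressure = p, log_conf = B,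
      mom_defect = mom_stress \<nu> \<alpha> T u B, conf_defect = conf_residual lam T u B \<rparr>"

definition entropy_var :: "(real \<Rightarrow> real^3 \<Rightarrow> real^3^3) \<Rightarrow> real \<Rightarrow> real^3 \<Rightarrow> real^3^3"
  where "entropy_var B t x = mat 1 - matrix_inv (conf B t x)"

definition energy_entropy_admissible :: "real \<Rightarrow> real set \<Rightarrow> reynolds_state \<Rightarrow> bool"
  where "energy_entropy_admissible \<alpha> T st \<longleftrightarrow>
    (AE t in lebesgue_on T.
      (\<integral>x. - mom_defect st t x \<Colon>\<^sub>F symgrad (velocity st t) x
           + \<alpha> / 2 * (entropy_var (log_conf st) t x \<Colon>\<^sub>F conf_defect st t x) \<partial>torus) \<le> 0)"

section \<open>Norms and the alignment coefficient\<close>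

text \<open>Measures of space-time sets and \<open>L\<^sup>2\<close> norms take values in \<^typ>\<open>ennreal\<close>, since the time
  interval may be unbounded or open.\<close>

definition esqrt :: "ennreal \<Rightarrow> ennreal"
  where "esqrt a = (if a = \<infinity> then \<infinity> else ennreal (sqrt (enn2real a)))"

definition L2norm :: "'a measure \<Rightarrow> ('a \<Rightarrow> 'b::real_normed_vector) \<Rightarrow> ennreal"
  where "L2norm M f = esqrt (\<integral>\<^sup>+ z. ennreal ((norm (f z))\<^sup>2) \<partial>M)"

definition Linf_norm :: "'a measure \<Rightarrow> ('a \<Rightarrow> 'b::real_normed_vector) \<Rightarrow> ennreal"
  where "Linf_norm M f = esssup M (\<lambda>z. ennreal (norm (f z)))"

definition slab :: "real set \<Rightarrow> (real \<times> (real^3)) measure"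
  where "slab E = lebesgue_on E \<Otimes>\<^sub>M torus"

definition alignment ::
  "real \<Rightarrow> real set \<Rightarrow> (real \<Rightarrow> real^3 \<Rightarrow> real^3) \<Rightarrow> (real \<Rightarrow> real^3 \<Rightarrow> real^3^3) \<Rightarrow> real set \<Rightarrow> ennreal"
  where "alignment lam T u B E =
    esssup (lebesgue_on E) (\<lambda>t.
      let G = entropy_var B t; S = conf_residual lam T u B t;
          d = L2norm torus G * L2norm torus S
      in if d = 0 then 0 else ennreal (max (- (\<integral>x. G x \<Colon>\<^sub>F S x \<partial>torus)) 0) / d)"

end

theory Submission
  imports Defs
begin

text \<open>
  Write \<open>S\<close> for the conformation residual. The bound on \<open>G = I - A\<^sup>-\<^sup>1\<close> is pointwise: with
  \<open>A\<^sup>-\<^sup>1 = e\<^sup>-\<^sup>B\<close> (\<open>matrix_inv_mexp\<close>) and submultiplicativity of the Frobenius norm, the exponential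
  series gives \<open>\<parallel>G\<parallel> \<le> e\<^sup>\<epsilon> - 1 \<le> e \<epsilon>\<close> wherever \<open>\<parallel>B\<parallel> \<le> \<epsilon> \<le> 1\<close> (\<open>norm_one_minus_inv_mexp_le\<close>), and this
  integrates over the slab.

  For the power bound, admissibility at almost every time says \<open>P + (\<alpha>/2) \<integral>G : S \<le> 0\<close>, so
  \<open>[P]\<^sub>+ \<le> (\<alpha>/2) [-\<integral>G : S]\<^sub>+\<close> (\<open>stress_power_le_of_admissible\<close>). By the definition of the alignment
  coefficient the right-hand side is at most \<open>(\<alpha>/2) \<eta> \<parallel>G(t)\<parallel> \<parallel>S(t)\<parallel>\<close> with spatial \<open>L\<^sup>2\<close> norms
  (\<open>alignment_AE\<close>). Integrating in time, the Cauchy--Schwarz inequality and Tonelli's theorem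
  (\<open>nn_integral_L2norm_mult_le\<close>) produce the space-time norms of \<open>G\<close> and \<open>S\<close>, and the first part bounds
  the former.

  The analytic input is that \<open>S\<close> is jointly continuous in space-time
  (\<open>continuous_on_conf_residual\<close>): this makes the slices square integrable, so that the alignment
  quotient can be cleared of its denominator, and gives the measurability for Tonelli's theorem.
  Since \<open>B\<close> does not commute with its derivatives, the derivative of \<open>e\<^sup>B\<close> has no scalar formula. It is
  obtained as a series \<open>dmexp\<close> by termwise differentiation (\<open>has_derivative_mexp\<close>), together with its
  joint continuity in base point and direction (\<open>continuous_on_dmexp\<close>).
\<close>

section \<open>The matrix exponential\<close>

lemma norm_matrix_sq: "(norm (M :: real^3^3))\<^sup>2 = (\<Sum>i\<in>UNIV. \<Sum>j\<in>UNIV. (M $ i $ j)\<^sup>2)"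
  unfolding power2_norm_eq_inner by (simp add: inner_vec_def power2_eq_square)

lemma norm_matrix_mult_le: "norm (M ** N) \<le> norm M * norm N" for M N :: "real^3^3"
proof -
  have "(norm (M ** N))\<^sup>2 = (\<Sum>i\<in>UNIV. \<Sum>j\<in>UNIV. (\<Sum>k\<in>UNIV. M $ i $ k * N $ k $ j)\<^sup>2)"
    unfolding norm_matrix_sq by (simp add: matrix_matrix_mult_def)
  also have "\<dots> \<le> (\<Sum>i\<in>UNIV. \<Sum>j\<in>UNIV. (\<Sum>k\<in>UNIV. (M $ i $ k)\<^sup>2) * (\<Sum>k\<in>UNIV. (N $ k $ j)\<^sup>2))"
    by (intro sum_mono Cauchy_Schwarz_ineq_sum)
  also have "\<dots> = (\<Sum>i\<in>UNIV. \<Sum>k\<in>UNIV. (M $ i $ k)\<^sup>2) * (\<Sum>j\<in>UNIV. \<Sum>k\<in>UNIV. (N $ k $ j)\<^sup>2)"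
    by (simp add: sum_product)
  also have "(\<Sum>j\<in>UNIV. \<Sum>k\<in>UNIV. (N $ k $ j)\<^sup>2) = (\<Sum>k\<in>UNIV. \<Sum>j\<in>UNIV. (N $ k $ j)\<^sup>2)"
    by (rule sum.swap)
  finally have "(norm (M ** N))\<^sup>2 \<le> (norm M * norm N)\<^sup>2"
    by (simp add: power_mult_distrib norm_matrix_sq)
  then show ?thesis
    by (rule power2_le_imp_le) simp
qed

lemma bounded_bilinear_matrix_mult:
  "bounded_bilinear ((**) :: real^3^3 \<Rightarrow> real^3^3 \<Rightarrow> real^3^3)"
proof
  fix a :: real and M M' N N' :: "real^3^3"
  show "(M + M') ** N = M ** N + M' ** N"
    by (simp add: matrix_matrix_mult_def vec_eq_iff sum.distrib distrib_right)
  show "M ** (N + N') = M ** N + M ** N'"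
    by (simp add: matrix_matrix_mult_def vec_eq_iff sum.distrib distrib_left)
  show "(a *\<^sub>R M) ** N = a *\<^sub>R (M ** N)"
    by (simp add: matrix_matrix_mult_def vec_eq_iff sum_distrib_left mult.assoc)
  show "M ** (a *\<^sub>R N) = a *\<^sub>R (M ** N)"
    by (simp add: matrix_matrix_mult_def vec_eq_iff sum_distrib_left mult.left_commute)
  show "\<exists>K. \<forall>(M :: real^3^3) (N :: real^3^3). norm (M ** N) \<le> norm M * norm N * K"
    by (rule exI[of _ 1]) (simp add: norm_matrix_mult_le)
qed

lemmas matrix_mult_bilinear_simps =
  bounded_bilinear.add_left[OF bounded_bilinear_matrix_mult]
  bounded_bilinear.add_right[OF bounded_bilinear_matrix_mult]
  bounded_bilinear.minus_left[OF bounded_bilinear_matrix_mult]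
  bounded_bilinear.minus_right[OF bounded_bilinear_matrix_mult]
  bounded_bilinear.scaleR_left[OF bounded_bilinear_matrix_mult]
  bounded_bilinear.scaleR_right[OF bounded_bilinear_matrix_mult]
  bounded_bilinear.zero_left[OF bounded_bilinear_matrix_mult]
  bounded_bilinear.zero_right[OF bounded_bilinear_matrix_mult]

lemmas continuous_on_matrix_mult [continuous_intros] =
  bounded_bilinear.continuous_on[OF bounded_bilinear_matrix_mult]

lemmas sums_matrix_mult_left =
  bounded_linear.sums[OF bounded_bilinear.bounded_linear_right[OF bounded_bilinear_matrix_mult]]

lemma mpow_0 [simp]: "mpow M 0 = mat 1"
  and mpow_Suc [simp]: "mpow M (Suc n) = M ** mpow M n"
  by (simp_all add: mpow_def)

text \<open>The power \<open>0\<close> must stay out: the identity has Frobenius norm \<open>\<surd>3\<close>. This sharp bound controls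
  \<open>e\<^sup>M - I\<close>; \<open>norm_mpow_le\<close> below absorbs the identity into a crude constant and only serves convergence.\<close>

lemma norm_mpow_Suc_le: "norm (mpow M (Suc n)) \<le> norm M ^ Suc n"
proof (induction n)
  case (Suc n)
  have "norm (mpow M (Suc (Suc n))) \<le> norm M * norm (mpow M (Suc n))"
    unfolding mpow_Suc[of _ "Suc n"] by (rule norm_matrix_mult_le)
  also have "\<dots> \<le> norm M * norm M ^ Suc n"
    by (rule mult_left_mono[OF Suc]) simp
  finally show ?case by simp
qed simp

lemma norm_mat1_le: "norm (mat 1 :: real^3^3) \<le> 3"
proof -
  have "(norm (mat 1 :: real^3^3))\<^sup>2 = 3"
    unfolding norm_matrix_sq mat_def by (simp add: if_distrib[of "\<lambda>x. x\<^sup>2"] cong: if_cong)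
  then have "(norm (mat 1 :: real^3^3))\<^sup>2 \<le> 3\<^sup>2" by simp
  then show ?thesis by (rule power2_le_imp_le) simp
qed

lemma norm_mpow_le:
  assumes "norm M \<le> R"
  shows "norm (mpow M n) \<le> 3 * R ^ n"
proof (cases n)
  case (Suc m)
  have "norm M ^ n \<le> R ^ n" using assms by (intro power_mono) simp_all
  moreover have "0 \<le> R ^ n" using order.trans[OF norm_ge_zero assms] by simp
  ultimately show ?thesis
    using norm_mpow_Suc_le[of M m] unfolding Suc by linarith
qed (simp add: norm_mat1_le)

lemma summable_scaled_exp_series: "summable (\<lambda>n. c * ((1 / fact n) * R ^ n))" for R c :: real
  using summable_mult[OF summable_exp[of R], of c] by (simp add: inverse_eq_divide)

lemma mexp_sums: "(\<lambda>n. (1 / fact n) *\<^sub>R mpow M n) sums mexp M"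
  unfolding mexp_def
proof (rule summable_sums, rule summable_comparison_test')
  show "norm ((1 / fact n) *\<^sub>R mpow M n) \<le> 3 * ((1 / fact n) * norm M ^ n)" for n
    using norm_mpow_le[of M "norm M" n] by (simp add: divide_simps)
qed (rule summable_scaled_exp_series)

text \<open>Subtracting the identity removes the term of order zero, and the remaining powers are bounded
  by the powers of \<open>norm M\<close>, which sum to the scalar exponential series without its first term.\<close>

lemma norm_mexp_minus_one_le: "norm (mexp M - mat 1) \<le> exp (norm M) - 1"
proof -
  let ?f = "\<lambda>n. (1 / fact (Suc n)) *\<^sub>R mpow M (Suc n)"
  let ?g = "\<lambda>n. (1 / fact (Suc n)) * norm M ^ Suc n"
  have f: "?f sums (mexp M - mat 1)"
    using sums_split_initial_segment[OF mexp_sums[of M], of 1] by simp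
  have "(\<lambda>n. (1 / fact n) * norm M ^ n) sums exp (norm M)"
    using exp_converges[of "norm M"] by (simp add: inverse_eq_divide)
  from sums_split_initial_segment[OF this, of 1] have g: "?g sums (exp (norm M) - 1)"
    by simp
  have le: "norm (?f n) \<le> ?g n" for n
    using mult_left_mono[OF norm_mpow_Suc_le[of M n], of "1 / fact (Suc n)"] by simp
  have "norm (suminf ?f) \<le> suminf ?g"
    by (rule norm_suminf_le[OF le sums_summable[OF g]])
  then show ?thesis using sums_unique[OF f] sums_unique[OF g] by simp
qed

text \<open>The Frechet derivatives of \<open>mpow\<close> and \<open>mexp\<close> at \<open>M\<close> in the direction \<open>H\<close>. Since \<open>H\<close> need not
  commute with \<open>M\<close>, the former is \<open>\<Sum>k<n. M\<^sup>k H M\<^sup>n\<^sup>-\<^sup>1\<^sup>-\<^sup>k\<close>, here unrolled by the product rule.\<close>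

primrec dmpow :: "real^3^3 \<Rightarrow> real^3^3 \<Rightarrow> nat \<Rightarrow> real^3^3"
  where
    "dmpow M H 0 = 0"
  | "dmpow M H (Suc n) = H ** mpow M n + M ** dmpow M H n"

definition dmexp :: "real^3^3 \<Rightarrow> real^3^3 \<Rightarrow> real^3^3"
  where "dmexp M H = (\<Sum>n. (1 / fact n) *\<^sub>R dmpow M H n)"

lemma has_derivative_mpow: "((\<lambda>M. mpow M n) has_derivative (\<lambda>H. dmpow M H n)) (at M within S)"
proof (induction n)
  case (Suc n)
  show ?case
    unfolding mpow_Suc dmpow.simps
    by (rule has_derivative_eq_rhs[OF bounded_bilinear.FDERIV[OF bounded_bilinear_matrix_mult has_derivative_ident Suc]])
      (simp add: add.commute)
qed simp

text \<open>The natural bound has a factor \<open>n\<close>, which \<open>2 ^ n\<close> dominates; the weaker form keeps the majorant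
  an exponential series.\<close>

lemma norm_dmpow_le:
  assumes "norm M \<le> R" and "1 \<le> R"
  shows "norm (dmpow M H n) \<le> 3 * (2 * R) ^ n * norm H"
proof (induction n)
  case (Suc n)
  have "norm (dmpow M H (Suc n)) \<le> norm H * norm (mpow M n) + norm M * norm (dmpow M H n)"
    unfolding dmpow.simps by (intro norm_triangle_mono norm_matrix_mult_le)
  also have "\<dots> \<le> norm H * (3 * R ^ n) + R * (3 * (2 * R) ^ n * norm H)"
    using assms by (intro add_mono mult_mono Suc norm_mpow_le) auto
  also have "\<dots> \<le> norm H * (3 * (R * (2 * R) ^ n)) + R * (3 * (2 * R) ^ n * norm H)"
  proof -
    have "R ^ n \<le> 1 * (2 * R) ^ n" using assms by (simp add: power_mono)
    also have "\<dots> \<le> R * (2 * R) ^ n" using assms by (intro mult_right_mono) auto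
    finally show ?thesis by (intro add_right_mono mult_left_mono) auto
  qed
  finally show ?case by (simp add: algebra_simps)
qed simp

lemma norm_dmexp_term_le:
  assumes "norm M \<le> R" and "1 \<le> R"
  shows "norm ((1 / fact n) *\<^sub>R dmpow M H n) \<le> 3 * ((1 / fact n) * (2 * R) ^ n) * norm H"
  using mult_left_mono[OF norm_dmpow_le[OF assms, of H n], of "1 / fact n"] by simp

lemma dmexp_sums: "(\<lambda>n. (1 / fact n) *\<^sub>R dmpow M H n) sums dmexp M H"
  unfolding dmexp_def
proof (rule summable_sums, rule summable_comparison_test')
  let ?R = "max 1 (norm M)"
  show "norm ((1 / fact n) *\<^sub>R dmpow M H n) \<le> (3 * norm H) * ((1 / fact n) * (2 * ?R) ^ n)" for n
    using norm_dmexp_term_le[of M ?R n H] by (simp add: mult_ac)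
qed (rule summable_scaled_exp_series)

text \<open>The differentiated series is dominated on balls by an exponential series, uniformly in the base
  point and linearly in the direction, so termwise differentiation is legitimate.\<close>

lemma has_derivative_mexp: "(mexp has_derivative dmexp M) (at M within S)"
proof -
  define R where "R = norm M + 1"
  have R: "1 \<le> R" and MR: "M \<in> ball 0 R" by (simp_all add: R_def)
  define a where "a n = 3 * ((1 / fact n) * (2 * R) ^ n)" for n
  have a: "summable a" unfolding a_def by (rule summable_scaled_exp_series)
  have bound: "norm ((1 / fact n) *\<^sub>R dmpow X H n) \<le> a n * norm H" if "X \<in> ball 0 R" for X H n
    unfolding a_def using that R by (intro norm_dmexp_term_le) auto
  have "\<exists>g. \<forall>X\<in>ball 0 R. (\<lambda>n. (1 / fact n) *\<^sub>R mpow X n) sums g X \<and>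
          (g has_derivative dmexp X) (at X within ball 0 R)"
  proof (rule has_derivative_series)
    fix e :: real assume "e > 0"
    have "\<forall>\<^sub>F n in sequentially. \<bar>\<Sum>k. a (k + n)\<bar> < e"
      using suminf_exist_split[OF \<open>e > 0\<close> a] by (auto simp: eventually_sequentially)
    then show "\<forall>\<^sub>F n in sequentially. \<forall>X\<in>ball 0 R. \<forall>H.
        norm ((\<Sum>i<n. (1 / fact i) *\<^sub>R dmpow X H i) - dmexp X H) \<le> e * norm H"
    proof eventually_elim
      case (elim n)
      show ?case
      proof (intro ballI allI)
        fix X H :: "real^3^3" assume X: "X \<in> ball 0 R"
        let ?f = "\<lambda>k. (1 / fact k) *\<^sub>R dmpow X H k"
        have sm: "summable (\<lambda>k. a (k + n) * norm H)"
          by (rule summable_mult2[OF summable_ignore_initial_segment[OF a]])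
        \<comment> \<open>The partial sum misses \<open>dmexp X H\<close> by the tail, which the tail of \<open>a\<close> dominates.\<close>
        have tail: "(\<Sum>k. ?f (k + n)) = dmexp X H - (\<Sum>i<n. ?f i)"
          by (rule sums_unique[symmetric], rule sums_split_initial_segment[OF dmexp_sums])
        have "norm (\<Sum>k. ?f (k + n)) \<le> (\<Sum>k. a (k + n) * norm H)"
          by (rule norm_suminf_le[OF bound[OF X] sm])
        also have "\<dots> = (\<Sum>k. a (k + n)) * norm H"
          by (rule suminf_mult2[symmetric, OF summable_ignore_initial_segment[OF a]])
        also have "\<dots> \<le> e * norm H"
          using elim by (intro mult_right_mono) auto
        finally show "norm ((\<Sum>i<n. ?f i) - dmexp X H) \<le> e * norm H"
          unfolding tail by (simp add: norm_minus_commute)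
      qed
    qed
  next
    show "((\<lambda>X. (1 / fact n) *\<^sub>R mpow X n) has_derivative (\<lambda>H. (1 / fact n) *\<^sub>R dmpow X H n))
        (at X within ball 0 R)" for n X
      by (intro has_derivative_scaleR_right has_derivative_mpow)
  qed (use MR mexp_sums in auto)
  then obtain g where g: "\<And>X. X \<in> ball 0 R \<Longrightarrow> (\<lambda>n. (1 / fact n) *\<^sub>R mpow X n) sums g X"
    and g': "\<And>X. X \<in> ball 0 R \<Longrightarrow> (g has_derivative dmexp X) (at X within ball 0 R)"
    by blast
  have eq: "g X = mexp X" if "X \<in> ball 0 R" for X
    using sums_unique2[OF g[OF that] mexp_sums] .
  have "(mexp has_derivative dmexp M) (at M within ball 0 R)"
    by (rule has_derivative_transform[OF MR _ g'[OF MR]]) (simp add: eq)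
  then have "(mexp has_derivative dmexp M) (at M)"
    using at_within_open[OF MR] by simp
  then show ?thesis by (rule has_derivative_at_withinI)
qed

lemma continuous_on_mexp: "continuous_on S mexp"
  by (rule has_derivative_continuous_on) (rule has_derivative_mexp)

lemma continuous_on_mpow: "continuous_on S (\<lambda>M. mpow M n)"
  by (rule has_derivative_continuous_on) (rule has_derivative_mpow)

lemma continuous_on_dmpow: "continuous_on S (\<lambda>(M, H). dmpow M H n)"
proof (induction n)
  case (Suc n)
  then have "continuous_on S (\<lambda>z. dmpow (fst z) (snd z) n)" by (simp add: case_prod_beta)
  then show ?case unfolding case_prod_beta dmpow.simps
    by (intro continuous_intros continuous_on_compose2[OF continuous_on_mpow[of UNIV]]) auto
qed (simp add: case_prod_beta)

text \<open>The same exponential majorant makes the series converge uniformly for base point and direction in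
  a common ball, and these products of balls are open and cover the space.\<close>

lemma continuous_on_dmexp: "continuous_on UNIV (\<lambda>(M, H). dmexp M H)"
proof -
  let ?F = "\<lambda>(M, H). dmexp M H"
  have ball: "continuous_on (ball 0 R \<times> ball 0 R) ?F" if R: "1 \<le> R" for R
  proof (rule uniform_limit_theorem)
    show "uniform_limit (ball 0 R \<times> ball 0 R)
        (\<lambda>n z. \<Sum>i<n. (1 / fact i) *\<^sub>R dmpow (fst z) (snd z) i) ?F sequentially"
      unfolding case_prod_beta dmexp_def
    proof (rule Weierstrass_m_test)
      fix n and z :: "(real^3^3) \<times> (real^3^3)" assume z: "z \<in> ball 0 R \<times> ball 0 R"
      have "norm ((1 / fact n) *\<^sub>R dmpow (fst z) (snd z) n)
          \<le> 3 * ((1 / fact n) * (2 * R) ^ n) * norm (snd z)"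
        using z R by (intro norm_dmexp_term_le) auto
      also have "\<dots> \<le> 3 * ((1 / fact n) * (2 * R) ^ n) * R"
        using z R by (intro mult_left_mono) auto
      finally show "norm ((1 / fact n) *\<^sub>R dmpow (fst z) (snd z) n)
          \<le> (3 * R) * ((1 / fact n) * (2 * R) ^ n)"
        by (simp add: mult_ac)
    qed (rule summable_scaled_exp_series)
    show "\<forall>\<^sub>F n in sequentially. continuous_on (ball 0 R \<times> ball 0 R)
        (\<lambda>z. \<Sum>i<n. (1 / fact i) *\<^sub>R dmpow (fst z) (snd z) i)"
      by (intro always_eventually allI continuous_on_sum continuous_on_scaleR continuous_on_const)
        (use continuous_on_dmpow in \<open>simp add: case_prod_beta\<close>)
  qed simp
  have "continuous (at z) ?F" for z
  proof -
    define R where "R = max (norm (fst z)) (norm (snd z)) + 1"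
    have "norm (fst z) < R" "norm (snd z) < R" "0 \<le> norm (fst z)"
      unfolding R_def by (linarith, linarith, simp)
    then have "1 \<le> R" "z \<in> ball 0 R \<times> ball 0 R"
      by (simp_all add: R_def mem_Times_iff max_def)
    moreover have "open (ball (0 :: real^3^3) R \<times> ball (0 :: real^3^3) R)"
      by (intro open_Times) auto
    ultimately show ?thesis
      using ball[of R] by (metis continuous_on_eq_continuous_at)
  qed
  then show ?thesis by (simp add: continuous_at_imp_continuous_on)
qed

text \<open>Along the line spanned by \<open>M\<close> everything commutes and the derivative of the exponential takes
  its scalar form.\<close>

lemma dmexp_scaleR_self: "dmexp (s *\<^sub>R M) M = M ** mexp (s *\<^sub>R M)"
proof -
  have pow: "dmpow (s *\<^sub>R M) M (Suc n) = real (Suc n) *\<^sub>R (M ** mpow (s *\<^sub>R M) n)" for n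
  proof (induction n)
    case (Suc n)
    have "dmpow (s *\<^sub>R M) M (Suc (Suc n)) =
        M ** mpow (s *\<^sub>R M) (Suc n) + (s *\<^sub>R M) ** dmpow (s *\<^sub>R M) M (Suc n)"
      by (rule dmpow.simps)
    also have "\<dots> = s *\<^sub>R (M ** (M ** mpow (s *\<^sub>R M) n)) +
        (s * real (Suc n)) *\<^sub>R (M ** (M ** mpow (s *\<^sub>R M) n))"
      unfolding Suc mpow_Suc
      by (simp only: matrix_mult_bilinear_simps scaleR_scaleR mult.commute)
    also have "\<dots> = (real (Suc (Suc n)) * s) *\<^sub>R (M ** (M ** mpow (s *\<^sub>R M) n))"
      unfolding scaleR_add_left[symmetric] by (simp add: algebra_simps)
    finally show ?case
      unfolding mpow_Suc by (simp only: matrix_mult_bilinear_simps scaleR_scaleR)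
  qed (simp add: matrix_mult_bilinear_simps)
  have "(1 / fact (Suc n)) *\<^sub>R dmpow (s *\<^sub>R M) M (Suc n) = M ** ((1 / fact n) *\<^sub>R mpow (s *\<^sub>R M) n)" for n
    unfolding pow by (simp add: matrix_mult_bilinear_simps del: of_nat_Suc)
  moreover have "(\<lambda>n. (1 / fact (Suc n)) *\<^sub>R dmpow (s *\<^sub>R M) M (Suc n)) sums dmexp (s *\<^sub>R M) M"
    using sums_split_initial_segment[OF dmexp_sums[of "s *\<^sub>R M" M], of 1] by simp
  ultimately have "(\<lambda>n. M ** ((1 / fact n) *\<^sub>R mpow (s *\<^sub>R M) n)) sums dmexp (s *\<^sub>R M) M"
    by (simp only:)
  then show ?thesis
    by (rule sums_unique2) (rule sums_matrix_mult_left[OF mexp_sums])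
qed

lemma mexp_comm: "mexp (s *\<^sub>R M) ** M = M ** mexp (s *\<^sub>R M)"
proof -
  have comm: "mpow (s *\<^sub>R M) n ** M = M ** mpow (s *\<^sub>R M) n" for n
    by (induction n) (simp_all add: matrix_mult_bilinear_simps flip: matrix_mul_assoc)
  have "(\<lambda>n. ((1 / fact n) *\<^sub>R mpow (s *\<^sub>R M) n) ** M) sums (mexp (s *\<^sub>R M) ** M)"
    by (rule bounded_linear.sums[OF bounded_bilinear.bounded_linear_left[OF
          bounded_bilinear_matrix_mult] mexp_sums])
  then show ?thesis
    using sums_unique2[OF sums_matrix_mult_left[OF mexp_sums[of "s *\<^sub>R M"], of M]]
    by (simp add: matrix_mult_bilinear_simps comm)
qed

lemma mexp_0: "mexp 0 = mat 1"
  using norm_mexp_minus_one_le[of 0] by simp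

text \<open>The product \<open>e\<^sup>s\<^sup>M e\<^sup>-\<^sup>s\<^sup>M\<close> has derivative zero in \<open>s\<close> and equals \<open>I\<close> at \<open>s = 0\<close>.\<close>

lemma mexp_mult_mexp_minus: "mexp M ** mexp (- M) = mat 1"
proof -
  define f where "f s = mexp (s *\<^sub>R M) ** mexp (s *\<^sub>R (- M))" for s :: real
  have curve: "((\<lambda>s. mexp (s *\<^sub>R X)) has_vector_derivative X ** mexp (s *\<^sub>R X)) (at s)" for X and s :: real
  proof -
    have "((\<lambda>s. s *\<^sub>R X) has_vector_derivative X) (at s)"
      by (auto intro!: derivative_eq_intros simp: has_vector_derivative_def)
    from vector_derivative_diff_chain_within[OF this has_derivative_mexp]
    show ?thesis by (simp add: dmexp_scaleR_self o_def)
  qed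
  have "(f has_vector_derivative 0) (at s)" for s
  proof -
    have "mexp (s *\<^sub>R M) ** (- M ** mexp (s *\<^sub>R - M)) + (M ** mexp (s *\<^sub>R M)) ** mexp (s *\<^sub>R - M) = 0"
      by (simp only: matrix_mult_bilinear_simps matrix_mul_assoc mexp_comm) simp
    then show ?thesis
      using bounded_bilinear.has_vector_derivative[OF bounded_bilinear_matrix_mult
          curve[where X = M and s = s] curve[where X = "- M" and s = s]]
      unfolding f_def by (simp only:)
  qed
  then obtain c where "\<And>s. s \<in> UNIV \<Longrightarrow> f s = c"
    using has_vector_derivative_zero_constant[OF convex_UNIV] by blast
  then have "f 1 = f 0" by simp
  then show ?thesis by (simp add: f_def mexp_0)
qed

lemma matrix_inv_mexp: "matrix_inv (mexp M) = mexp (- M)"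
proof -
  have *: "mexp M ** mexp (- M) = mat 1" "mexp (- M) ** mexp M = mat 1"
    using mexp_mult_mexp_minus[of M] mexp_mult_mexp_minus[of "- M"] by simp_all
  then have "mexp M ** matrix_inv (mexp M) = mat 1"
    unfolding matrix_inv_def by (intro someI2[where Q = "\<lambda>A. mexp M ** A = mat 1"]) auto
  then have "mexp (- M) ** (mexp M ** matrix_inv (mexp M)) = mexp (- M)"
    by simp
  then show ?thesis by (simp add: matrix_mul_assoc *)
qed

text \<open>The pointwise core of the bound on \<open>G\<close>: \<open>\<parallel>I - e\<^sup>-\<^sup>M\<parallel> \<le> e\<^sup>\<epsilon> - 1 \<le> \<epsilon> e\<^sup>\<epsilon> \<le> e \<epsilon>\<close>.\<close>

lemma norm_one_minus_inv_mexp_le: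
  assumes "norm M \<le> \<epsilon>" and "\<epsilon> \<le> 1"
  shows "norm (mat 1 - matrix_inv (mexp M)) \<le> exp 1 * \<epsilon>"
proof -
  have \<epsilon>: "0 \<le> \<epsilon>" using assms(1) norm_ge_zero order.trans by blast
  have "norm (mat 1 - matrix_inv (mexp M)) = norm (mexp (- M) - mat 1)"
    by (simp add: matrix_inv_mexp norm_minus_commute)
  also have "\<dots> \<le> exp \<epsilon> - 1"
    using norm_mexp_minus_one_le[of "- M"] assms(1)
    by (smt (verit) exp_le_cancel_iff norm_minus_cancel)
  also have "\<dots> \<le> exp \<epsilon> * \<epsilon>"
  proof -
    have "exp \<epsilon> * (1 - \<epsilon>) \<le> exp \<epsilon> * exp (- \<epsilon>)"
      using exp_ge_add_one_self[of "- \<epsilon>"] by (intro mult_left_mono) auto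
    then show ?thesis by (simp add: exp_minus algebra_simps)
  qed
  also have "\<dots> \<le> exp 1 * \<epsilon>"
    using assms \<epsilon> by (intro mult_right_mono) auto
  finally show ?thesis .
qed

section \<open>Continuity of the conformation residual\<close>

lemma smooth_fieldD:
  assumes "smooth_field T f"
  shows "continuous_on (T \<times> UNIV) (\<lambda>(t, x). f t x)"
    and "continuous_on (T \<times> UNIV) (\<lambda>(t, x). dt T f t x)"
    and "continuous_on (T \<times> UNIV) (\<lambda>(t, x). pd j (f t) x)"
    and "t \<in> T \<Longrightarrow> (\<lambda>s. f s x) differentiable (at t within T)"
    and "t \<in> T \<Longrightarrow> (\<lambda>h. f t (x + h *\<^sub>R axis j 1)) differentiable (at 0)"
proof -
  have "Ck T (Suc 0) f" using assms by (simp only: smooth_field_def)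
  then show "continuous_on (T \<times> UNIV) (\<lambda>(t, x). f t x)"
    and "continuous_on (T \<times> UNIV) (\<lambda>(t, x). dt T f t x)"
    and "continuous_on (T \<times> UNIV) (\<lambda>(t, x). pd j (f t) x)"
    and "t \<in> T \<Longrightarrow> (\<lambda>s. f s x) differentiable (at t within T)"
    and "t \<in> T \<Longrightarrow> (\<lambda>h. f t (x + h *\<^sub>R axis j 1)) differentiable (at 0)"
    unfolding Ck.simps by blast+
qed

text \<open>Makes the one-sided time derivative unique at every point of the time interval, endpoints
  included.\<close>

lemma at_within_interval_neq_bot:
  fixes T :: "real set"
  assumes "is_interval T" and "interior T \<noteq> {}" and "t \<in> T"
  shows "at t within T \<noteq> bot"
proof -
  have "\<not> (\<exists>a. T = {a})" using assms(2) interior_singleton by auto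
  then have "t islimpt T"
    using assms(1,3) is_interval_connected by (intro connected_imp_perfect) auto
  then show ?thesis by (simp add: trivial_limit_within)
qed

lemma dt_conf:
  assumes "(\<lambda>s. B s x) differentiable (at t within T)" and "at t within T \<noteq> bot"
  shows "dt T (conf B) t x = dmexp (B t x) (dt T B t x)"
proof -
  have "((\<lambda>s. B s x) has_vector_derivative dt T B t x) (at t within T)"
    unfolding dt_def using assms(1) vector_derivative_works by blast
  from vector_derivative_diff_chain_within[OF this has_derivative_mexp]
  have "((\<lambda>s. conf B s x) has_vector_derivative dmexp (B t x) (dt T B t x)) (at t within T)"
    by (simp add: o_def conf_def)
  then show ?thesis
    unfolding dt_def[of T "conf B"] by (rule vector_derivative_within[OF assms(2)])
qed

lemma pd_conf:
  assumes "(\<lambda>h. B t (x + h *\<^sub>R axis j 1)) differentiable (at 0)"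
  shows "pd j (conf B t) x = dmexp (B t x) (pd j (B t) x)"
proof -
  have "((\<lambda>h. B t (x + h *\<^sub>R axis j 1)) has_vector_derivative pd j (B t) x) (at 0)"
    unfolding pd_def using assms vector_derivative_works by blast
  from vector_derivative_diff_chain_within[OF this has_derivative_mexp]
  have "((\<lambda>h. conf B t (x + h *\<^sub>R axis j 1)) has_vector_derivative
      dmexp (B t x) (pd j (B t) x)) (at 0)"
    by (simp add: o_def conf_def)
  then show ?thesis
    unfolding pd_def[of j "conf B t"] by (rule vector_derivative_at)
qed

lemma vgrad_eq_pd:
  assumes "\<And>j. (\<lambda>h. v (x + h *\<^sub>R axis j 1)) differentiable (at 0)"
  shows "vgrad v x = (\<chi> i j. pd j v x $ i)"
proof -
  have "pd j (\<lambda>y. v y $ i) x = pd j v x $ i" for i j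
  proof -
    have "((\<lambda>h. v (x + h *\<^sub>R axis j 1)) has_vector_derivative pd j v x) (at 0)"
      unfolding pd_def using assms vector_derivative_works by blast
    then have "((\<lambda>h. v (x + h *\<^sub>R axis j 1) $ i) has_vector_derivative pd j v x $ i) (at 0)"
      by (rule bounded_linear.has_vector_derivative[OF bounded_linear_vec_nth])
    then show ?thesis
      unfolding pd_def[of j "\<lambda>y. v y $ i"] by (rule vector_derivative_at)
  qed
  then show ?thesis by (simp add: vgrad_def)
qed

lemma continuous_on_transpose [continuous_intros]:
  fixes f :: "'a::topological_space \<Rightarrow> real^3^3"
  assumes "continuous_on S f"
  shows "continuous_on S (\<lambda>x. transpose (f x))"
  unfolding transpose_def by (intro continuous_intros assms)

lemma continuous_on_conf:
  assumes "continuous_on S (\<lambda>(t, x). B t x)"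
  shows "continuous_on S (\<lambda>(t, x). conf B t x)"
  using continuous_on_compose2[OF continuous_on_mexp[of UNIV] assms]
  by (simp add: case_prod_beta conf_def)

lemma continuous_on_entropy_var:
  assumes "continuous_on S (\<lambda>(t, x). B t x)"
  shows "continuous_on S (\<lambda>(t, x). entropy_var B t x)"
proof -
  have "continuous_on S (\<lambda>z. - (case z of (t, x) \<Rightarrow> B t x))"
    using assms by (rule continuous_on_minus)
  from continuous_on_compose2[OF continuous_on_mexp[of UNIV] this]
  have "continuous_on S (\<lambda>z. mat 1 - mexp (- (case z of (t, x) \<Rightarrow> B t x)))"
    by (intro continuous_on_diff continuous_on_const) simp
  then show ?thesis
    by (simp add: entropy_var_def conf_def matrix_inv_mexp case_prod_beta)
qed

text \<open>By the chain rule, \<open>\<partial>A\<close> is \<open>dmexp B (\<partial>B)\<close> for the time derivative and for each space derivative,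
  and \<open>dmexp\<close> is jointly continuous; the remaining terms are built from \<open>A\<close>, \<open>u\<close> and \<open>\<nabla>u\<close>, which are
  continuous as well.\<close>

lemma continuous_on_conf_residual:
  assumes T: "is_interval T" "interior T \<noteq> {}"
    and u: "smooth_field T u" and B: "smooth_field T B"
  shows "continuous_on (T \<times> UNIV) (\<lambda>(t, x). conf_residual lam T u B t x)"
proof -
  define D where "D H z = dmexp (B (fst z) (snd z)) (H z)" for H :: "real \<times> (real^3) \<Rightarrow> real^3^3" and z
  \<comment> \<open>\<open>D\<close>, \<open>L\<close> and \<open>A\<close> are \<open>\<partial>A\<close> (with \<open>H\<close> standing for \<open>\<partial>B\<close>), \<open>\<nabla>u\<close> and \<open>A\<close> as functions on space-time.\<close>
  define L where "L z = (\<chi> i j. pd j (u (fst z)) (snd z) $ i)" for z :: "real \<times> (real^3)"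
  define A where "A z = conf B (fst z) (snd z)" for z
  have cB: "continuous_on (T \<times> UNIV) (\<lambda>z. B (fst z) (snd z))"
    using smooth_fieldD(1)[OF B] by (simp add: case_prod_beta)
  have D: "continuous_on (T \<times> UNIV) (D H)" if "continuous_on (T \<times> UNIV) H" for H
    using continuous_on_compose2[OF continuous_on_dmexp continuous_on_Pair[OF cB that]]
    unfolding D_def by simp
  have A: "continuous_on (T \<times> UNIV) A"
    using continuous_on_conf[OF smooth_fieldD(1)[OF B]] by (simp add: A_def case_prod_beta)
  have pdu: "continuous_on (T \<times> UNIV) (\<lambda>z. pd j (u (fst z)) (snd z))" for j
    using smooth_fieldD(3)[OF u] by (simp add: case_prod_beta)
  have L: "continuous_on (T \<times> UNIV) L"
    unfolding L_def by (intro continuous_intros pdu)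
  have u0: "continuous_on (T \<times> UNIV) (\<lambda>z. u (fst z) (snd z))"
    using smooth_fieldD(1)[OF u] by (simp add: case_prod_beta)
  have Dt: "continuous_on (T \<times> UNIV) (D (\<lambda>z. dt T B (fst z) (snd z)))"
    using smooth_fieldD(2)[OF B] by (intro D) (simp add: case_prod_beta)
  have Dx: "continuous_on (T \<times> UNIV) (D (\<lambda>z. pd k (B (fst z)) (snd z)))" for k
    using smooth_fieldD(3)[OF B] by (intro D) (simp add: case_prod_beta)
  have "continuous_on (T \<times> UNIV) (\<lambda>z. D (\<lambda>z. dt T B (fst z) (snd z)) z
      + (\<Sum>k\<in>UNIV. (u (fst z) (snd z) $ k) *\<^sub>R D (\<lambda>z. pd k (B (fst z)) (snd z)) z)
      - L z ** A z - A z ** transpose (L z) + inverse lam *\<^sub>R (A z - mat 1))"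
    by (intro continuous_intros A L u0 Dt Dx)
  then show ?thesis
  proof (rule continuous_on_eq)
    fix z :: "real \<times> (real^3)" assume "z \<in> T \<times> UNIV"
    then obtain t x where z: "z = (t, x)" and t: "t \<in> T" by auto
    note Bd = dt_conf[OF smooth_fieldD(4)[OF B t] at_within_interval_neq_bot[OF T t]]
      pd_conf[where B = B and t = t, OF smooth_fieldD(5)[OF B t]]
    show "D (\<lambda>z. dt T B (fst z) (snd z)) z
        + (\<Sum>k\<in>UNIV. (u (fst z) (snd z) $ k) *\<^sub>R D (\<lambda>z. pd k (B (fst z)) (snd z)) z)
        - L z ** A z - A z ** transpose (L z) + inverse lam *\<^sub>R (A z - mat 1)
        = (case z of (t, x) \<Rightarrow> conf_residual lam T u B t x)"
      by (simp add: z conf_residual_def Let_def advect_def Bd vgrad_eq_pd[OF smooth_fieldD(5)[OF u t]]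
          D_def L_def A_def)
  qed
qed

lemma continuous_on_slice:
  assumes "continuous_on (T \<times> UNIV) (\<lambda>(t, x). f t x)" and "t \<in> T"
  shows "continuous_on S (f t)"
proof -
  have "continuous_on S (\<lambda>x. (t, x))" by (intro continuous_intros)
  from continuous_on_compose2[OF assms(1) this] assms(2) show ?thesis by auto
qed

section \<open>\<open>L\<^sup>2\<close> norms on products and on the slab\<close>

lemma esqrt_squared: "(esqrt a)\<^sup>2 = a"
  by (cases a) (simp_all add: esqrt_def ennreal_power top_power_ennreal)

lemma ennreal_power2_le_imp_le: "x \<le> y" if "x\<^sup>2 \<le> y\<^sup>2" for x y :: ennreal
proof (cases x; cases y)
  fix a b assume *: "0 \<le> a" "x = ennreal a" "0 \<le> b" "y = ennreal b"
  then have "a\<^sup>2 \<le> b\<^sup>2" using that by (simp add: ennreal_power)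
  then have "a \<le> b" using *(3) by (rule power2_le_imp_le)
  with * show "x \<le> y" by (simp add: ennreal_leI)
qed (use that in \<open>auto simp: top_power_ennreal ennreal_power top_unique\<close>)

lemma L2norm_squared: "(L2norm M f)\<^sup>2 = (\<integral>\<^sup>+ z. ennreal ((norm (f z))\<^sup>2) \<partial>M)"
  by (simp add: L2norm_def esqrt_squared)

lemma borel_measurable_esqrt [measurable]: "esqrt \<in> borel_measurable borel"
  unfolding esqrt_def by measurable

lemma L2norm_le_AE_bound:
  assumes "AE z in M. norm (f z) \<le> c" and "0 \<le> c"
  shows "L2norm M f \<le> ennreal c * esqrt (emeasure M (space M))"
proof (rule ennreal_power2_le_imp_le)
  have "(L2norm M f)\<^sup>2 \<le> (\<integral>\<^sup>+ z. ennreal (c\<^sup>2) \<partial>M)"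
    unfolding L2norm_squared
  proof (rule nn_integral_mono_AE)
    show "AE z in M. ennreal ((norm (f z))\<^sup>2) \<le> ennreal (c\<^sup>2)"
      using assms(1) by eventually_elim (intro ennreal_leI power_mono norm_ge_zero)
  qed
  then show "(L2norm M f)\<^sup>2 \<le> (ennreal c * esqrt (emeasure M (space M)))\<^sup>2"
    using assms(2) by (simp add: power_mult_distrib esqrt_squared ennreal_power)
qed

lemma L2norm_eq_0_imp_AE:
  assumes "f \<in> borel_measurable M" and "L2norm M f = 0"
  shows "AE z in M. f z = 0"
proof -
  have "(\<integral>\<^sup>+ z. ennreal ((norm (f z))\<^sup>2) \<partial>M) = 0"
    using L2norm_squared[of M f] assms(2) by simp
  then show ?thesis
    using assms(1) by (subst (asm) nn_integral_0_iff_AE) auto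
qed

lemma borel_measurable_L2norm_slice:
  fixes f :: "'a \<times> 'b \<Rightarrow> 'c::{real_normed_vector, second_countable_topology}"
  assumes "sigma_finite_measure N" and [measurable]: "f \<in> borel_measurable (M \<Otimes>\<^sub>M N)"
  shows "(\<lambda>t. L2norm N (\<lambda>x. f (t, x))) \<in> borel_measurable M"
proof -
  interpret N: sigma_finite_measure N by fact
  show ?thesis unfolding L2norm_def by measurable
qed

lemma nn_integral_L2norm_slice_squared:
  fixes f :: "'a \<times> 'b \<Rightarrow> 'c::{real_normed_vector, second_countable_topology}"
  assumes "sigma_finite_measure N" and [measurable]: "f \<in> borel_measurable (M \<Otimes>\<^sub>M N)"
  shows "(\<integral>\<^sup>+ t. (L2norm N (\<lambda>x. f (t, x)))\<^sup>2 \<partial>M) = (L2norm (M \<Otimes>\<^sub>M N) f)\<^sup>2"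
proof -
  interpret N: sigma_finite_measure N by fact
  show ?thesis unfolding L2norm_squared by (rule N.nn_integral_fst) measurable
qed

text \<open>Cauchy--Schwarz in the first variable only; Tonelli turns the squared slice norms into the
  squared norms on the product. In \<^typ>\<open>ennreal\<close> this covers infinite norms.\<close>

lemma nn_integral_L2norm_mult_le:
  fixes f :: "'a \<times> 'b \<Rightarrow> 'c::{real_normed_vector, second_countable_topology}"
    and g :: "'a \<times> 'b \<Rightarrow> 'd::{real_normed_vector, second_countable_topology}"
  assumes N: "sigma_finite_measure N"
    and f: "f \<in> borel_measurable (M \<Otimes>\<^sub>M N)" and g: "g \<in> borel_measurable (M \<Otimes>\<^sub>M N)"
  shows "(\<integral>\<^sup>+ t. L2norm N (\<lambda>x. f (t, x)) * L2norm N (\<lambda>x. g (t, x)) \<partial>M)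
          \<le> L2norm (M \<Otimes>\<^sub>M N) f * L2norm (M \<Otimes>\<^sub>M N) g"
proof (rule ennreal_power2_le_imp_le)
  show "(\<integral>\<^sup>+ t. L2norm N (\<lambda>x. f (t, x)) * L2norm N (\<lambda>x. g (t, x)) \<partial>M)\<^sup>2
      \<le> (L2norm (M \<Otimes>\<^sub>M N) f * L2norm (M \<Otimes>\<^sub>M N) g)\<^sup>2"
    unfolding power_mult_distrib nn_integral_L2norm_slice_squared[OF N f, symmetric]
      nn_integral_L2norm_slice_squared[OF N g, symmetric]
    by (intro Cauchy_Schwarz_nn_integral borel_measurable_L2norm_slice N f g)
qed

lemma sigma_finite_torus: "sigma_finite_measure torus"
  unfolding torus_def
  by (rule finite_measure.axioms(1)[OF finite_measure_lebesgue_on[OF lmeasurable_cbox]])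

text \<open>The product of the two Lebesgue \<open>\<sigma>\<close>-algebras contains the Borel sets of space-time, so joint
  continuity gives joint measurability even when \<open>E\<close> is only Lebesgue measurable.\<close>

lemma borel_measurable_slab:
  fixes f :: "real \<times> (real^3) \<Rightarrow> 'b::topological_space"
  assumes "continuous_on (T \<times> UNIV) f" and "E \<subseteq> T"
  shows "f \<in> borel_measurable (slab E)"
proof -
  have "(\<lambda>t. t) \<in> lebesgue_on E \<rightarrow>\<^sub>M (borel :: real measure)"
    and "(\<lambda>x. x) \<in> torus \<rightarrow>\<^sub>M (borel :: (real^3) measure)"
    using id_borel_measurable_lebesgue_on by (auto simp: torus_def id_def)
  then have "(\<lambda>z. (fst z, snd z)) \<in> slab E \<rightarrow>\<^sub>M borel \<Otimes>\<^sub>M borel"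
    unfolding slab_def by (intro measurable_Pair measurable_compose[OF measurable_fst]
        measurable_compose[OF measurable_snd])
  then have "(\<lambda>z. z) \<in> slab E \<rightarrow>\<^sub>M borel"
    by (simp add: borel_prod)
  then have "(\<lambda>z. z) \<in> slab E \<rightarrow>\<^sub>M restrict_space borel (T \<times> UNIV)"
    using assms(2)
    by (intro measurable_restrict_space2) (auto simp: slab_def space_pair_measure)
  from measurable_compose[OF this borel_measurable_continuous_on_restrict[OF assms(1)]]
  show ?thesis .
qed

lemma integrable_torus_continuous:
  fixes f :: "real^3 \<Rightarrow> 'b::euclidean_space"
  assumes "\<And>S. continuous_on S f"
  shows "integrable torus f"
  unfolding torus_def by (rule continuous_imp_integrable) (rule assms)

lemma L2norm_torus_finite:
  fixes f :: "real^3 \<Rightarrow> 'b::euclidean_space"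
  assumes "\<And>S. continuous_on S f"
  shows "L2norm torus f < \<infinity>"
proof -
  have "integrable torus (\<lambda>x. (norm (f x))\<^sup>2)"
    by (intro integrable_torus_continuous continuous_intros assms)
  then have "(\<integral>\<^sup>+ x. ennreal ((norm (f x))\<^sup>2) \<partial>torus) < \<infinity>"
    by (subst nn_integral_eq_integral) auto
  then show ?thesis
    using L2norm_squared[of torus f] by (cases "L2norm torus f") (auto simp: top_power_ennreal)
qed

section \<open>Alignment and admissibility\<close>

text \<open>Cleared of its denominator, the alignment coefficient controls \<open>[-\<integral>G : S]\<^sub>+\<close> at almost every
  time. This needs the denominator to be finite, which holds by continuity on the compact cell, and
  in the case of a vanishing denominator that one of \<open>G\<close>, \<open>S\<close> vanishes almost everywhere.\<close>

lemma alignment_AE: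
  assumes "\<And>t S. t \<in> E \<Longrightarrow> continuous_on S (entropy_var B t)"
    and "\<And>t S. t \<in> E \<Longrightarrow> continuous_on S (conf_residual lam T u B t)"
    and "E \<in> sets lebesgue"
  shows "AE t in lebesgue_on E.
    ennreal (max (- (\<integral>x. entropy_var B t x \<Colon>\<^sub>F conf_residual lam T u B t x \<partial>torus)) 0)
      \<le> alignment lam T u B E *
         (L2norm torus (entropy_var B t) * L2norm torus (conf_residual lam T u B t))"
proof -
  let ?G = "entropy_var B" and ?S = "conf_residual lam T u B"
  let ?N = "\<lambda>t. ennreal (max (- (\<integral>x. ?G t x \<Colon>\<^sub>F ?S t x \<partial>torus)) 0)"
  let ?d = "\<lambda>t. L2norm torus (?G t) * L2norm torus (?S t)"
  have "AE t in lebesgue_on E. (if ?d t = 0 then 0 else ?N t / ?d t) \<le> alignment lam T u B E"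
    unfolding alignment_def Let_def by (rule esssup_AE)
  moreover have "AE t in lebesgue_on E. t \<in> E"
    using AE_space[of "lebesgue_on E"] by simp
  ultimately show ?thesis
  proof eventually_elim
    case (elim t)
    note cG = assms(1)[OF elim(2)] and cS = assms(2)[OF elim(2)]
    show "?N t \<le> alignment lam T u B E * ?d t"
    proof (cases "?d t = 0")
      case True
      have "AE x in torus. ?G t x \<Colon>\<^sub>F ?S t x = 0"
      proof (cases "L2norm torus (?G t) = 0")
        case True
        from L2norm_eq_0_imp_AE[OF borel_measurable_integrable[OF integrable_torus_continuous[OF cG]] this]
        show ?thesis by eventually_elim (simp add: frob_eq_inner)
      next
        case False
        with \<open>?d t = 0\<close> have "L2norm torus (?S t) = 0" by simp
        from L2norm_eq_0_imp_AE[OF borel_measurable_integrable[OF integrable_torus_continuous[OF cS]] this]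
        show ?thesis by eventually_elim (simp add: frob_eq_inner)
      qed
      then have "(\<integral>x. ?G t x \<Colon>\<^sub>F ?S t x \<partial>torus) = 0"
        by (rule integral_eq_zero_AE)
      then show ?thesis by simp
    next
      case False
      have "?d t < \<infinity>"
        using L2norm_torus_finite[OF cG] L2norm_torus_finite[OF cS] by (simp add: ennreal_mult_less_top)
      \<comment> \<open>Cancelling in \<^typ>\<open>ennreal\<close> requires a denominator that is neither zero nor infinite.\<close>
      then have "?d t / ?d t = 1"
        using False by (intro ennreal_divide_self) (simp_all only: infinity_ennreal_def not_False_eq_True)
      then have "?N t = ?N t / ?d t * ?d t"
        unfolding ennreal_divide_times by (simp only: mult_1_right)
      also have "\<dots> \<le> alignment lam T u B E * ?d t"
        using elim(1) False by (intro mult_right_mono) auto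
      finally show ?thesis .
    qed
  qed
qed

text \<open>If the stress term is integrable, the admissibility integral splits into \<open>P\<close> and the entropy
  term. Otherwise \<open>P\<close> is zero, the default value of the Bochner integral, and the bound is trivial.\<close>

lemma stress_power_le_of_admissible:
  assumes adm: "(\<integral>x. - mom_stress \<nu> \<alpha> T u B t x \<Colon>\<^sub>F symgrad (u t) x + \<alpha> / 2 * g x \<partial>torus) \<le> 0"
    and g: "integrable torus g" and "0 < \<alpha>"
  shows "max (stress_power \<nu> \<alpha> T u B t) 0 \<le> \<alpha> / 2 * max (- (\<integral>x. g x \<partial>torus)) 0"
proof (cases "integrable torus (\<lambda>x. - mom_stress \<nu> \<alpha> T u B t x \<Colon>\<^sub>F symgrad (u t) x)")
  case True
  have "stress_power \<nu> \<alpha> T u B t + \<alpha> / 2 * (\<integral>x. g x \<partial>torus) \<le> 0"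
    using adm True g by (simp add: stress_power_def)
  then have "stress_power \<nu> \<alpha> T u B t \<le> \<alpha> / 2 * (- (\<integral>x. g x \<partial>torus))"
    by simp
  also have "\<dots> \<le> \<alpha> / 2 * max (- (\<integral>x. g x \<partial>torus)) 0"
    using assms(3) by (intro mult_left_mono) auto
  finally show ?thesis using assms(3) by (intro max.boundedI) simp_all
next
  case False
  then have "stress_power \<nu> \<alpha> T u B t = 0"
    by (simp add: stress_power_def not_integrable_integral_eq)
  then show ?thesis using assms(3) by simp
qed

lemma AE_lebesgue_on_subset:
  assumes "AE t in lebesgue_on T. P t" and "E \<subseteq> T"
    and "T \<in> sets lebesgue" and "E \<in> sets lebesgue"
  shows "AE t in lebesgue_on E. P t"
proof -
  have "AE t in lebesgue. t \<in> T \<longrightarrow> P t"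
    using assms(1,3) by (simp add: AE_restrict_space_iff)
  then have "AE t in lebesgue. t \<in> E \<longrightarrow> P t"
    by eventually_elim (use assms(2) in blast)
  then show ?thesis
    using assms(4) by (simp add: AE_restrict_space_iff)
qed

theorem proposition9p1:
  fixes \<nu> \<alpha> lam \<epsilon> :: real
    and T E :: "real set"
    and u :: "real \<Rightarrow> real^3 \<Rightarrow> real^3"
    and p :: "real \<Rightarrow> real^3 \<Rightarrow> real"
    and B :: "real \<Rightarrow> real^3 \<Rightarrow> real^3^3"
  assumes "\<nu> > 0" and "\<alpha> > 0" and "lam > 0"
    and "is_interval T" and "interior T \<noteq> {}"
    and "smooth_field T u" and "smooth_field T p" and "smooth_field T B"
    and "\<forall>t\<in>T. \<forall>x. vdiv (u t) x = 0"
    and "\<forall>s\<in>T. \<forall>t\<in>T. torus_mean (u s) = torus_mean (u t)"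
    and "\<forall>t\<in>T. \<forall>x. transpose (B t x) = B t x"
    and "E \<in> sets lebesgue" and "E \<subseteq> T"
    and "0 < \<epsilon>" and "\<epsilon> \<le> 1"
    and "Linf_norm (slab E) (\<lambda>(t, x). B t x) \<le> ennreal \<epsilon>"
  shows "L2norm (slab E) (\<lambda>(t, x). entropy_var B t x)
           \<le> ennreal (exp 1 * \<epsilon>) * esqrt (emeasure (slab E) (space (slab E))) \<and>
         (energy_entropy_admissible \<alpha> T (residual_matching_state \<nu> \<alpha> lam T u p B) \<longrightarrow>
           (\<integral>\<^sup>+ t. ennreal (max (stress_power \<nu> \<alpha> T u B t) 0) \<partial>lebesgue_on E)
             \<le> ennreal (\<alpha> * exp 1 / 2) * alignment lam T u B E * ennreal \<epsilon>
                * esqrt (emeasure (slab E) (space (slab E)))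
                * L2norm (slab E) (\<lambda>(t, x). conf_residual lam T u B t x))"
proof (rule conjI)
  let ?G = "entropy_var B" and ?S = "conf_residual lam T u B"
  let ?\<eta> = "alignment lam T u B E" and ?m = "esqrt (emeasure (slab E) (space (slab E)))"
  have "AE z in slab E. ennreal (norm (case z of (t, x) \<Rightarrow> B t x)) \<le> ennreal \<epsilon>"
    using esssup_AE[of "\<lambda>z. ennreal (norm (case z of (t, x) \<Rightarrow> B t x))" "slab E"]
    by eventually_elim (rule order.trans[OF _ assms(16)[unfolded Linf_norm_def]])
  then have "AE z in slab E. norm (case z of (t, x) \<Rightarrow> ?G t x) \<le> exp 1 * \<epsilon>"
  proof eventually_elim
    case (elim z)
    then have "norm (B (fst z) (snd z)) \<le> \<epsilon>"
      using assms(14) by (simp add: case_prod_beta)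
    from norm_one_minus_inv_mexp_le[OF this assms(15)] show ?case
      by (simp add: case_prod_beta entropy_var_def conf_def)
  qed
  then show G_le: "L2norm (slab E) (\<lambda>(t, x). ?G t x) \<le> ennreal (exp 1 * \<epsilon>) * ?m"
    using assms(14) by (intro L2norm_le_AE_bound) auto
  show "energy_entropy_admissible \<alpha> T (residual_matching_state \<nu> \<alpha> lam T u p B) \<longrightarrow>
      (\<integral>\<^sup>+ t. ennreal (max (stress_power \<nu> \<alpha> T u B t) 0) \<partial>lebesgue_on E)
        \<le> ennreal (\<alpha> * exp 1 / 2) * ?\<eta> * ennreal \<epsilon> * ?m * L2norm (slab E) (\<lambda>(t, x). ?S t x)"
  proof
    assume adm: "energy_entropy_admissible \<alpha> T (residual_matching_state \<nu> \<alpha> lam T u p B)"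
    have contG: "continuous_on (T \<times> UNIV) (\<lambda>(t, x). ?G t x)"
      by (rule continuous_on_entropy_var) (rule smooth_fieldD(1)[OF assms(8)])
    have contS: "continuous_on (T \<times> UNIV) (\<lambda>(t, x). ?S t x)"
      by (rule continuous_on_conf_residual) fact+
    have slice: "continuous_on X (?G t)" "continuous_on X (?S t)" if "t \<in> T" for t X
      using continuous_on_slice[OF contG that] continuous_on_slice[OF contS that] by auto
    have measG: "(\<lambda>(t, x). ?G t x) \<in> borel_measurable (lebesgue_on E \<Otimes>\<^sub>M torus)"
      and measS: "(\<lambda>(t, x). ?S t x) \<in> borel_measurable (lebesgue_on E \<Otimes>\<^sub>M torus)"
      using borel_measurable_slab[OF contG assms(13)] borel_measurable_slab[OF contS assms(13)]
      by (simp_all add: slab_def)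
    have T: "T \<in> sets lebesgue"
      using assms(4) by (simp add: real_interval_borel_measurable)
    have "AE t in lebesgue_on T. t \<in> T \<and>
        (\<integral>x. - mom_stress \<nu> \<alpha> T u B t x \<Colon>\<^sub>F symgrad (u t) x
          + \<alpha> / 2 * (?G t x \<Colon>\<^sub>F ?S t x) \<partial>torus) \<le> 0"
      using adm AE_space[of "lebesgue_on T"]
      by (simp add: energy_entropy_admissible_def residual_matching_state_def)
    then have adm_E: "AE t in lebesgue_on E. t \<in> T \<and>
        (\<integral>x. - mom_stress \<nu> \<alpha> T u B t x \<Colon>\<^sub>F symgrad (u t) x
          + \<alpha> / 2 * (?G t x \<Colon>\<^sub>F ?S t x) \<partial>torus) \<le> 0"
      by (rule AE_lebesgue_on_subset) (use assms(12,13) T in auto)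
    have aligned: "AE t in lebesgue_on E.
        ennreal (max (- (\<integral>x. ?G t x \<Colon>\<^sub>F ?S t x \<partial>torus)) 0)
          \<le> ?\<eta> * (L2norm torus (?G t) * L2norm torus (?S t))"
      by (rule alignment_AE) (use slice assms(12,13) in auto)
    have "AE t in lebesgue_on E. ennreal (max (stress_power \<nu> \<alpha> T u B t) 0)
        \<le> (ennreal (\<alpha> / 2) * ?\<eta>) * (L2norm torus (?G t) * L2norm torus (?S t))"
      using adm_E aligned
    proof eventually_elim
      case (elim t)
      then have t: "t \<in> T" by simp
      have int: "integrable torus (\<lambda>x. ?G t x \<Colon>\<^sub>F ?S t x)"
        unfolding frob_eq_inner
        by (intro integrable_torus_continuous continuous_intros slice t)
      have "ennreal (max (stress_power \<nu> \<alpha> T u B t) 0)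
          \<le> ennreal (\<alpha> / 2) * ennreal (max (- (\<integral>x. ?G t x \<Colon>\<^sub>F ?S t x \<partial>torus)) 0)"
        using stress_power_le_of_admissible[OF _ int assms(2)] elim(1) assms(2)
        by (simp add: ennreal_leI flip: ennreal_mult)
      also have "\<dots> \<le> ennreal (\<alpha> / 2) * (?\<eta> * (L2norm torus (?G t) * L2norm torus (?S t)))"
        using elim(2) by (intro mult_left_mono) auto
      finally show ?case by (simp add: mult.assoc)
    qed
    then have "(\<integral>\<^sup>+ t. ennreal (max (stress_power \<nu> \<alpha> T u B t) 0) \<partial>lebesgue_on E)
        \<le> (\<integral>\<^sup>+ t. (ennreal (\<alpha> / 2) * ?\<eta>) * (L2norm torus (?G t) * L2norm torus (?S t)) \<partial>lebesgue_on E)"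
      by (rule nn_integral_mono_AE)
    also have "\<dots> = (ennreal (\<alpha> / 2) * ?\<eta>) *
        (\<integral>\<^sup>+ t. L2norm torus (?G t) * L2norm torus (?S t) \<partial>lebesgue_on E)"
      using borel_measurable_L2norm_slice[OF sigma_finite_torus measG]
        borel_measurable_L2norm_slice[OF sigma_finite_torus measS]
      by (intro nn_integral_cmult borel_measurable_times) auto
    also have "\<dots> \<le> (ennreal (\<alpha> / 2) * ?\<eta>) *
        (L2norm (slab E) (\<lambda>(t, x). ?G t x) * L2norm (slab E) (\<lambda>(t, x). ?S t x))"
      using nn_integral_L2norm_mult_le[OF sigma_finite_torus measG measS]
      by (intro mult_left_mono) (auto simp: slab_def)
    also have "\<dots> \<le> (ennreal (\<alpha> / 2) * ?\<eta>) *
        ((ennreal (exp 1 * \<epsilon>) * ?m) * L2norm (slab E) (\<lambda>(t, x). ?S t x))"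
      by (intro mult_left_mono mult_right_mono G_le) auto
    also have "\<dots> = ennreal (\<alpha> * exp 1 / 2) * ?\<eta> * ennreal \<epsilon> * ?m * L2norm (slab E) (\<lambda>(t, x). ?S t x)"
    proof -
      have "ennreal (\<alpha> * exp 1 / 2) = ennreal (\<alpha> / 2) * ennreal (exp 1)"
        using assms(2) by (simp flip: ennreal_mult)
      moreover have "ennreal (exp 1 * \<epsilon>) = ennreal (exp 1) * ennreal \<epsilon>"
        using assms(14) by (simp add: ennreal_mult)
      ultimately show ?thesis by (simp add: mult_ac)
    qed
    finally show "(\<integral>\<^sup>+ t. ennreal (max (stress_power \<nu> \<alpha> T u B t) 0) \<partial>lebesgue_on E)
        \<le> ennreal (\<alpha> * exp 1 / 2) * ?\<eta> * ennreal \<epsilon> * ?m * L2norm (slab E) (\<lambda>(t, x). ?S t x)" .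
  qed
qed

end
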